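(* Let $F\colon\mathbb{B}^{2L}\to\mathbb{B}^{2L}$ be the Boolean Delta-Notch system over a graph $\mathcal{G}$ as in the context. For every $y\in\mathbb{B}^{2L}$ and every fixed point $x$ of $F$ with $x\in\kappa(y)$, there is a path from $y$ to $x$ in $AD_F$.
   Context: Let $L\ge 1$ and let $\mathcal{G}$ be an undirected connected graph without loops on the vertex set $C=\{1,\dots,L\}$. For $i\in C$ let $S(i)$ be the set of neighbours of $i$ in $\mathcal{G}$. $\mathbb{B}=\{0,1\}$. States of $\mathbb{B}^{2L}$ are written $(n,d)=(n_1,\dots,n_L,d_1,\dots,d_L)$. The Boolean Delta-Notch system is $F\colon\mathbb{B}^{2L}\to\mathbb{B}^{2L}$ with $F_i(n,d)=\bigvee_{j\in S(i)}d_j$ (empty disjunction $=0$) and $F_{i+L}(n,d)=1-n_i$ for $i\in C$. The asynchronous dynamics $AD_F$ has an edge from $x$ to the state obtained by flipping coordinate $i$ whenever $F_i(x)\neq x_i$. For $x\in\mathbb{B}^{2L}$, $I\subseteq\{1,\dots,2L\}$, the subspace $x[I]$ is $\{y: y_i=x_i\ \forall i\notin I\}$. A trap space is a subspace closed under successors in $AD_F$. $\kappa(y)$ denotes the unique minimal (for inclusion) trap space containing $y$. *)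

theory Defs
  imports Main "HOL-Library.FuncSet"
begin

text \<open>Truth values represent \<open>0\<close> and \<open>1\<close>. A state of dimension \<open>N\<close> is an extensional function on
  \<open>{1..N}\<close>, so that equality of states is equality of their \<open>N\<close> coordinates.\<close>

definition states :: "nat \<Rightarrow> (nat \<Rightarrow> bool) set" where
  "states N = {1..N} \<rightarrow>\<^sub>E (UNIV :: bool set)"

definition flip :: "(nat \<Rightarrow> bool) \<Rightarrow> nat \<Rightarrow> (nat \<Rightarrow> bool)" where
  "flip x i = x(i := \<not> x i)"

definition async_dynamics ::
    "nat \<Rightarrow> ((nat \<Rightarrow> bool) \<Rightarrow> (nat \<Rightarrow> bool)) \<Rightarrow> ((nat \<Rightarrow> bool) \<times> (nat \<Rightarrow> bool)) set" where
  "async_dynamics N F = {(x, flip x i) | x i. x \<in> states N \<and> i \<in> {1..N} \<and> F x i \<noteq> x i}"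

definition subspace_at :: "nat \<Rightarrow> (nat \<Rightarrow> bool) \<Rightarrow> nat set \<Rightarrow> (nat \<Rightarrow> bool) set" where
  "subspace_at N x I = {y \<in> states N. \<forall>i \<in> {1..N} - I. y i = x i}"

definition trap_space ::
    "nat \<Rightarrow> ((nat \<Rightarrow> bool) \<Rightarrow> (nat \<Rightarrow> bool)) \<Rightarrow> (nat \<Rightarrow> bool) set \<Rightarrow> bool" where
  "trap_space N F T \<longleftrightarrow>
     (\<exists>x \<in> states N. \<exists>I \<subseteq> {1..N}. T = subspace_at N x I) \<and>
     (\<forall>u v. u \<in> T \<and> (u, v) \<in> async_dynamics N F \<longrightarrow> v \<in> T)"

definition minimal_trap_space_containing ::
    "nat \<Rightarrow> ((nat \<Rightarrow> bool) \<Rightarrow> (nat \<Rightarrow> bool)) \<Rightarrow> (nat \<Rightarrow> bool) \<Rightarrow> (nat \<Rightarrow> bool) set \<Rightarrow> bool" where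
  "minimal_trap_space_containing N F y T \<longleftrightarrow>
     trap_space N F T \<and> y \<in> T \<and>
     (\<forall>T'. trap_space N F T' \<and> y \<in> T' \<and> T' \<subseteq> T \<longrightarrow> T' = T)"

definition kappa ::
    "nat \<Rightarrow> ((nat \<Rightarrow> bool) \<Rightarrow> (nat \<Rightarrow> bool)) \<Rightarrow> (nat \<Rightarrow> bool) \<Rightarrow> (nat \<Rightarrow> bool) set" where
  "kappa N F y = (THE T. minimal_trap_space_containing N F y T)"

text \<open>An undirected graph is given by its symmetric adjacency relation.\<close>

definition connected_loopless_graph :: "nat \<Rightarrow> (nat \<times> nat) set \<Rightarrow> bool" where
  "connected_loopless_graph L E \<longleftrightarrow>
     E \<subseteq> {1..L} \<times> {1..L} \<and> sym E \<and> irrefl E \<and>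
     (\<forall>i \<in> {1..L}. \<forall>j \<in> {1..L}. (i, j) \<in> E\<^sup>*)"

definition neighbours :: "(nat \<times> nat) set \<Rightarrow> nat \<Rightarrow> nat set" where
  "neighbours E i = {j. (i, j) \<in> E}"

text \<open>Coordinate \<open>i\<close> with \<open>1 \<le> i \<le> L\<close> holds \<open>n\<^sub>i\<close> and coordinate \<open>i + L\<close> holds \<open>d\<^sub>i\<close>.\<close>

definition delta_notch ::
    "nat \<Rightarrow> (nat \<times> nat) set \<Rightarrow> (nat \<Rightarrow> bool) \<Rightarrow> (nat \<Rightarrow> bool)" where
  "delta_notch L E x =
     (\<lambda>k \<in> {1..2 * L}. if k \<le> L then (\<exists>j \<in> neighbours E k. x (j + L)) else \<not> x (k - L))"

text \<open>The definite description in \<open>kappa\<close> is well-defined.\<close>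

lemma subspace_at_eqI:
  assumes "z \<in> subspace_at N x I"
  shows "subspace_at N x I = subspace_at N z I"
  using assms by (auto simp: subspace_at_def)

lemma trap_space_Int:
  assumes "trap_space N F S" "trap_space N F T" "y \<in> S" "y \<in> T"
  shows "trap_space N F (S \<inter> T)"
proof -
  obtain a I where I: "I \<subseteq> {1..N}" "S = subspace_at N a I"
    using assms(1) by (auto simp: trap_space_def)
  obtain b J where J: "J \<subseteq> {1..N}" "T = subspace_at N b J"
    using assms(2) by (auto simp: trap_space_def)
  have "S = subspace_at N y I" "T = subspace_at N y J"
    using I J assms(3,4) subspace_at_eqI by blast+
  then have "S \<inter> T = subspace_at N y (I \<inter> J)"
    by (auto simp: subspace_at_def)
  moreover have "y \<in> states N" using assms(3) I by (simp add: subspace_at_def)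
  moreover have "I \<inter> J \<subseteq> {1..N}" using I by blast
  ultimately show ?thesis
    using assms(1,2) unfolding trap_space_def by blast
qed

lemma ex1_minimal_trap_space_containing:
  assumes y: "y \<in> states N"
  shows "\<exists>!T. minimal_trap_space_containing N F y T"
proof -
  let ?P = "\<lambda>T. trap_space N F T \<and> y \<in> T"
  have "subspace_at N y {1..N} = states N" by (auto simp: subspace_at_def)
  moreover have "v \<in> states N" if "(u, v) \<in> async_dynamics N F" for u v
    using that by (auto simp: async_dynamics_def flip_def states_def PiE_iff extensional_def)
  ultimately have full: "?P (states N)"
    using y unfolding trap_space_def by blast
  have fin: "finite (states N)" by (simp add: states_def finite_PiE)
  have sub: "T \<subseteq> states N" if "?P T" for T
    using that by (auto simp: trap_space_def subspace_at_def)
  have finP: "finite {T. ?P T}"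
    by (rule finite_subset[of _ "Pow (states N)"]) (use sub fin in auto)
  obtain M where M: "?P M" "\<And>T. ?P T \<Longrightarrow> T \<subseteq> M \<Longrightarrow> T = M"
    using finite_has_minimal[OF finP] full by blast
  show ?thesis
  proof (rule ex1I[of _ M])
    show "minimal_trap_space_containing N F y M"
      using M unfolding minimal_trap_space_containing_def by blast
    fix T assume T: "minimal_trap_space_containing N F y T"
    then have "?P (M \<inter> T)"
      using M(1) trap_space_Int unfolding minimal_trap_space_containing_def by blast
    then have "M \<inter> T = M" "M \<inter> T = T"
      using M(2) T unfolding minimal_trap_space_containing_def by blast+
    then show "T = M" by simp
  qed
qed

lemma delta_notch_states: "delta_notch L E \<in> states (2 * L) \<rightarrow> states (2 * L)"
  by (simp add: delta_notch_def states_def)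

end

theory Submission
  imports Defs
begin

text \<open>Call a cell \<open>i\<close> locked in \<open>y\<close> if it has \<open>(n\<^sub>i, d\<^sub>i) = (0, 1)\<close> and all its neighbours have
  \<open>(n, d) = (1, 0)\<close>. Locked cells and their neighbours keep their values forever, so fixing them
  defines a trap space containing \<open>\<kappa>(y)\<close>, and every fixed point \<open>x \<in> \<kappa>(y)\<close> has \<open>d = 1\<close> on locked
  cells. Conversely, from \<open>y\<close> one can switch off \<open>d\<close> in all cells that are not locked:
  raise \<open>d\<close> in the cells in state \<open>(0, 0)\<close> next to a cell with \<open>d = 1\<close>, then raise \<open>n\<close> next to all
  cells with \<open>d = 1\<close>, then lower \<open>d\<close> wherever \<open>n = 1\<close>. The cells with \<open>d = 1\<close> in \<open>x\<close> are pairwise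
  non-adjacent, so now all their neighbours have \<open>d = 0\<close>; hence they can lower \<open>n\<close> and raise \<open>d\<close>,
  after which every other cell has a neighbour with \<open>d = 1\<close> and can raise \<open>n\<close> and lower \<open>d\<close>.\<close>

text \<open>Flip the coordinates where \<open>v\<close> and \<open>w\<close> differ one at a time,
  in any order: every state met on the way mixes \<open>v\<close> and \<open>w\<close>, so the last
  assumption enables each remaining flip.\<close>

lemma async_dynamics_rtrancl_if_locally_constant:
  assumes "v \<in> states N" "w \<in> states N"
    and "\<And>u k. \<lbrakk>u \<in> states N; \<forall>j. u j = v j \<or> u j = w j; v k \<noteq> w k\<rbrakk> \<Longrightarrow> F u k = w k"
  shows "(v, w) \<in> (async_dynamics N F)\<^sup>*"
  using assms
proof (induction "card {k \<in> {1..N}. v k \<noteq> w k}" arbitrary: v)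
  case 0
  have "v = w"
    using 0 by (intro PiE_ext[of v "{1..N}" "\<lambda>_. UNIV" w]) (auto simp: states_def)
  then show ?case by simp
next
  case (Suc m)
  from Suc.hyps(2) have "{k \<in> {1..N}. v k \<noteq> w k} \<noteq> {}"
    by (metis card.empty nat.distinct(1))
  then obtain k where k: "k \<in> {1..N}" "v k \<noteq> w k" by blast
  let ?v = "flip v k"
  have "F v k = w k" using Suc.prems k by blast
  then have step: "(v, ?v) \<in> async_dynamics N F"
    using k Suc.prems(1) by (auto simp: async_dynamics_def)
  have v: "?v \<in> states N"
    using Suc.prems(1) k by (auto simp: flip_def states_def PiE_iff extensional_def)
  have vk: "?v k = w k" "\<And>j. j \<noteq> k \<Longrightarrow> ?v j = v j"
    using k by (auto simp: flip_def)
  have "{j \<in> {1..N}. ?v j \<noteq> w j} = {j \<in> {1..N}. v j \<noteq> w j} - {k}"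
    using k by (auto simp: flip_def)
  then have "m = card {j \<in> {1..N}. ?v j \<noteq> w j}"
    using Suc.hyps(2) k by simp
  \<comment> \<open>A mixture of \<open>?v\<close> and \<open>w\<close> is also a mixture of
    \<open>v\<close> and \<open>w\<close>, so the assumption on \<open>F\<close> passes to
    \<open>?v\<close>.\<close>
  moreover have "F u j = w j"
    if "u \<in> states N" "\<forall>j. u j = ?v j \<or> u j = w j" "?v j \<noteq> w j" for u j
    using that vk by (intro Suc.prems(3)) metis+
  ultimately have "(?v, w) \<in> (async_dynamics N F)\<^sup>*"
    using Suc.hyps(1) v Suc.prems(2) by blast
  with step show ?case by (rule converse_rtrancl_into_rtrancl)
qed

definition cells :: "nat \<Rightarrow> (nat \<Rightarrow> bool) \<Rightarrow> (nat \<Rightarrow> bool) \<Rightarrow> nat \<Rightarrow> bool" where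
  "cells L n d = (\<lambda>k \<in> {1..2 * L}. if k \<le> L then n k else d (k - L))"

lemma cells_states: "cells L n d \<in> states (2 * L)"
  by (simp add: cells_def states_def)

lemma cells_notch: "i \<in> {1..L} \<Longrightarrow> cells L n d i = n i"
  by (auto simp: cells_def)

lemma cells_delta: "i \<in> {1..L} \<Longrightarrow> cells L n d (i + L) = d i"
  by (auto simp: cells_def)

lemma cells_of_state: "v \<in> states (2 * L) \<Longrightarrow> cells L v (\<lambda>i. v (i + L)) = v"
  by (auto simp: cells_def states_def PiE_iff extensional_def restrict_def)

lemma delta_notch_notch:
  "i \<in> {1..L} \<Longrightarrow> delta_notch L E v i \<longleftrightarrow> (\<exists>j \<in> neighbours E i. v (j + L))"
  by (auto simp: delta_notch_def)

lemma delta_notch_delta: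
  "i \<in> {1..L} \<Longrightarrow> delta_notch L E v (i + L) \<longleftrightarrow> \<not> v i"
  by (auto simp: delta_notch_def)

lemma coordinate_cases:
  fixes k L :: nat
  assumes "k \<in> {1..2 * L}"
  obtains (notch) "k \<in> {1..L}" | (delta) i where "i \<in> {1..L}" "k = i + L"
proof (cases "k \<le> L")
  case True
  then show ?thesis using assms notch by auto
next
  case False
  then show ?thesis using assms delta[of "k - L"] by auto
qed

lemma cells_neq_imp: "cells L n d k \<noteq> cells L n' d' k \<Longrightarrow> k \<in> {1..2 * L}"
  by (auto simp: cells_def split: if_splits)

text \<open>The target of a notch coordinate depends only on \<open>d\<close>, which is frozen here,
  so the flips stay enabled in whatever order they are made.\<close>

lemma update_notch:
  assumes "E \<subseteq> {1..L} \<times> {1..L}"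
    and "\<And>i. \<lbrakk>i \<in> {1..L}; n' i \<noteq> n i\<rbrakk> \<Longrightarrow> n' i \<longleftrightarrow> (\<exists>j \<in> neighbours E i. d j)"
  shows "(cells L n d, cells L n' d) \<in> (async_dynamics (2 * L) (delta_notch L E))\<^sup>*"
proof (rule async_dynamics_rtrancl_if_locally_constant[OF cells_states cells_states])
  fix u k
  assume u: "\<forall>j. u j = cells L n d j \<or> u j = cells L n' d j"
    and neq: "cells L n d k \<noteq> cells L n' d k"
  from cells_neq_imp[OF neq] show "delta_notch L E u k = cells L n' d k"
  proof (cases rule: coordinate_cases)
    case notch
    have "u (j + L) = d j" if "j \<in> neighbours E k" for j
    proof -
      have "j \<in> {1..L}" using that assms(1) by (auto simp: neighbours_def)
      then show ?thesis using u cells_delta by metis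
    qed
    moreover have "n' k \<noteq> n k" using neq notch by (simp add: cells_notch)
    ultimately show ?thesis
      using assms(2)[of k] notch by (simp add: delta_notch_notch cells_notch)
  next
    case (delta i)
    then show ?thesis using neq by (simp add: cells_delta)
  qed
qed

lemma update_delta:
  assumes "\<And>i. \<lbrakk>i \<in> {1..L}; d' i \<noteq> d i\<rbrakk> \<Longrightarrow> d' i \<longleftrightarrow> \<not> n i"
  shows "(cells L n d, cells L n d') \<in> (async_dynamics (2 * L) (delta_notch L E))\<^sup>*"
proof (rule async_dynamics_rtrancl_if_locally_constant[OF cells_states cells_states])
  fix u k
  assume u: "\<forall>j. u j = cells L n d j \<or> u j = cells L n d' j"
    and neq: "cells L n d k \<noteq> cells L n d' k"
  from cells_neq_imp[OF neq] show "delta_notch L E u k = cells L n d' k"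
  proof (cases rule: coordinate_cases)
    case notch
    then show ?thesis using neq by (simp add: cells_notch)
  next
    case (delta i)
    have "u i = n i" using u cells_notch[OF delta(1)] by metis
    moreover have "d' i \<noteq> d i" using neq delta by (simp add: cells_delta)
    ultimately show ?thesis
      using assms[of i] delta by (simp add: delta_notch_delta cells_delta)
  qed
qed

text \<open>Intersecting \<open>kappa\<close> with \<open>T\<close> gives a trap space containing
  \<open>y\<close>, so minimality applies.\<close>

lemma kappa_subset:
  assumes "trap_space N F T" "y \<in> T"
  shows "kappa N F y \<subseteq> T"
proof -
  have "y \<in> states N" using assms by (auto simp: trap_space_def subspace_at_def)
  from theI'[OF ex1_minimal_trap_space_containing[OF this]]
  have k: "minimal_trap_space_containing N F y (kappa N F y)"
    unfolding kappa_def .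
  then have "trap_space N F (kappa N F y \<inter> T)" "y \<in> kappa N F y \<inter> T"
    using assms trap_space_Int unfolding minimal_trap_space_containing_def by blast+
  then have "kappa N F y \<inter> T = kappa N F y"
    using k unfolding minimal_trap_space_containing_def by blast
  then show ?thesis by blast
qed

lemma trap_spaceI:
  assumes "y \<in> states N"
    and "\<And>u k. \<lbrakk>u \<in> states N; \<forall>i \<in> K. u i = y i; k \<in> K\<rbrakk> \<Longrightarrow> F u k = y k"
    and "K \<subseteq> {1..N}"
  shows "trap_space N F (subspace_at N y ({1..N} - K))"
proof -
  have *: "subspace_at N y ({1..N} - K) = {u \<in> states N. \<forall>i \<in> K. u i = y i}"
    using assms(3) by (auto simp: subspace_at_def)
  have "flip u i \<in> states N \<and> (\<forall>k \<in> K. flip u i k = y k)"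
    if "u \<in> states N" "\<forall>i \<in> K. u i = y i" "i \<in> {1..N}" "F u i \<noteq> u i" for u i
  proof -
    have "i \<notin> K" using assms(2)[OF that(1,2)] that(2,4) by metis
    then show ?thesis
      using that by (auto simp: flip_def states_def PiE_iff extensional_def)
  qed
  then have "\<forall>u v. u \<in> subspace_at N y ({1..N} - K) \<and> (u, v) \<in> async_dynamics N F \<longrightarrow>
      v \<in> subspace_at N y ({1..N} - K)"
    unfolding * async_dynamics_def by blast
  then show ?thesis
    unfolding trap_space_def using assms(1) by blast
qed

lemma kappa_delta_locked:
  assumes "E \<subseteq> {1..L} \<times> {1..L}" "sym E" "y \<in> states (2 * L)"
    and x: "x \<in> kappa (2 * L) (delta_notch L E) y"
    and i: "i \<in> {1..L}" "\<not> y i" "y (i + L)"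
    and nb: "\<And>j. j \<in> neighbours E i \<Longrightarrow> y j \<and> \<not> y (j + L)"
  shows "x (i + L)"
proof -
  let ?N = "neighbours E i"
  let ?K = "{i, i + L} \<union> ?N \<union> (\<lambda>j. j + L) ` ?N"
  let ?T = "subspace_at (2 * L) y ({1..2 * L} - ?K)"
  have N: "j \<in> {1..L}" "i \<in> neighbours E j" if "j \<in> ?N" for j
    using that assms(1,2) by (auto simp: neighbours_def sym_def)
  have K: "?K \<subseteq> {1..2 * L}" using i N by fastforce
  have "trap_space (2 * L) (delta_notch L E) ?T"
  proof (rule trap_spaceI[OF assms(3) _ K])
    fix u k
    assume u: "\<forall>k \<in> ?K. u k = y k" and "k \<in> ?K"
    then consider "k = i" | "k = i + L" | "k \<in> ?N" | j where "j \<in> ?N" "k = j + L"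
      by blast
    then show "delta_notch L E u k = y k"
    proof cases
      case 1
      then show ?thesis using u i nb by (auto simp: delta_notch_notch)
    next
      case 2
      then show ?thesis using u i by (auto simp: delta_notch_delta)
    next
      case 3
      have "u (i + L)" using u i by blast
      then show ?thesis using 3 N nb by (auto simp: delta_notch_notch)
    next
      case (4 j)
      then show ?thesis using u N nb by (auto simp: delta_notch_delta)
    qed
  qed
  moreover have "y \<in> ?T" using assms(3) by (simp add: subspace_at_def)
  ultimately have "x \<in> ?T" using kappa_subset x by blast
  then show ?thesis using i K by (auto simp: subspace_at_def)
qed

theorem theorem10:
  fixes L :: nat and E :: "(nat \<times> nat) set"
    and F :: "(nat \<Rightarrow> bool) \<Rightarrow> (nat \<Rightarrow> bool)"
    and x y :: "nat \<Rightarrow> bool"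
  assumes "L \<ge> 1"
    and "connected_loopless_graph L E"
    and "F = delta_notch L E"
    and "y \<in> states (2 * L)"
    and "x \<in> states (2 * L)"
    and "F x = x"
    and "x \<in> kappa (2 * L) F y"
  shows "(y, x) \<in> (async_dynamics (2 * L) F)\<^sup>*"
proof -
  have E: "E \<subseteq> {1..L} \<times> {1..L}" "sym E"
    using assms(2) by (auto simp: connected_loopless_graph_def)
  have nbE: "j \<in> {1..L}" "i \<in> neighbours E j" if "j \<in> neighbours E i" for i j
    using that E by (auto simp: neighbours_def sym_def)
  define dx where "dx = (\<lambda>i. x (i + L))"
  define dy where "dy = (\<lambda>i. y (i + L))"
  have nx: "x i \<longleftrightarrow> (\<exists>j \<in> neighbours E i. dx j)" "dx i \<longleftrightarrow> \<not> x i" if "i \<in> {1..L}" for i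
    using delta_notch_notch[OF that, of E x] delta_notch_delta[OF that, of E x] assms(3,6)
    by (auto simp: dx_def)
  \<comment> \<open>Raising \<open>d\<close> first matters: a cell in state (0, 1) whose neighbours
    all have d = 0, one of them in state (0, 0), is not locked but could not yet raise n.\<close>
  define d1 where "d1 = (\<lambda>i. dy i \<or> (\<not> y i \<and> (\<exists>j \<in> neighbours E i. dy j)))"
  define n1 where "n1 = (\<lambda>i. y i \<or> (\<exists>j \<in> neighbours E i. d1 j))"
  define d2 where "d2 = (\<lambda>i. d1 i \<and> \<not> n1 i)"
  define n2 where "n2 = (\<lambda>i. n1 i \<and> \<not> dx i)"
  define d3 where "d3 = (\<lambda>i. d2 i \<or> dx i)"
  \<comment> \<open>\<open>d2\<close> survives only at locked cells: next to a cell with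
    \<open>dy\<close>, a cell where \<open>d1\<close> fails must have n = 1 and d = 0.\<close>
  have d2: "dx i" if "i \<in> {1..L}" "d2 i" for i
  proof -
    have no_nb: "\<not> d1 j" if "j \<in> neighbours E i" for j
      using \<open>d2 i\<close> that by (auto simp: d2_def n1_def)
    have i: "\<not> y i" "dy i"
      using \<open>d2 i\<close> no_nb by (auto simp: d2_def n1_def d1_def)
    have "y j \<and> \<not> dy j" if "j \<in> neighbours E i" for j
      using no_nb[OF that] nbE(2)[OF that] i(2) by (auto simp: d1_def)
    then show ?thesis
      using kappa_delta_locked[OF E assms(4), of x i] assms(3,7) that(1) i
      by (simp add: dx_def dy_def)
  qed
  \<comment> \<open>By the fixed-point equations a neighbour of a cell with \<open>dx\<close> has n
    = 1 in \<open>x\<close>, so \<open>dx\<close> fails there, and with it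
    \<open>d2\<close>.\<close>
  have no_d2: "\<not> d2 j" if "i \<in> {1..L}" "dx i" "j \<in> neighbours E i" for i j
    using d2 nx nbE that by blast
  let ?R = "(async_dynamics (2 * L) (delta_notch L E))\<^sup>*"
  have "(cells L y dy, cells L y d1) \<in> ?R"
    by (rule update_delta) (auto simp: d1_def)
  also have "(cells L y d1, cells L n1 d1) \<in> ?R"
    by (rule update_notch[OF E(1)]) (auto simp: n1_def)
  also have "(cells L n1 d1, cells L n1 d2) \<in> ?R"
    by (rule update_delta) (auto simp: d2_def)
  also have "(cells L n1 d2, cells L n2 d2) \<in> ?R"
    by (rule update_notch[OF E(1)]) (use no_d2 in \<open>auto simp: n2_def\<close>)
  also have "(cells L n2 d2, cells L n2 d3) \<in> ?R"
    by (rule update_delta) (auto simp: d3_def n2_def)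
  \<comment> \<open>Notch values only rise here: where \<open>x i\<close> is false,
    \<open>dx i\<close> holds and \<open>n2 i\<close> is already false; where it is true, some
    neighbour has \<open>dx\<close>, hence \<open>d3\<close>.\<close>
  also have "(cells L n2 d3, cells L x d3) \<in> ?R"
    by (rule update_notch[OF E(1)]) (use nx in \<open>auto simp: d3_def n2_def\<close>)
  also have "(cells L x d3, cells L x dx) \<in> ?R"
    by (rule update_delta) (use nx in \<open>auto simp: d3_def\<close>)
  finally show ?thesis
    using cells_of_state assms(3-5) by (simp add: dx_def dy_def)
qed

end
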